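(* Let $\mathbb{F}_q$ be a finite field with $q$ elements and let $f\in\mathbb{F}_q[x]$ be a polynomial of degree $d>0$. Then the cardinality of its image set $V_f=\{f(\alpha)\mid\alpha\in\mathbb{F}_q\}$ is $$\#(V_f)=\sum_{i=1}^d(-1)^{i-1}N_i\,\sigma_i\left(1,\frac12,\ldots,\frac1d\right),$$ where, for $1\le k\le d$, $N_k=\#\{(x_1,\ldots,x_k)\in\mathbb{F}_q^k\mid f(x_1)=\cdots=f(x_k)\}$, and $\sigma_i$ denotes the $i$-th elementary symmetric function in $d$ variables.
   Context: The identity is between rational numbers; $\sigma_i(1,\frac12,\ldots,\frac1d)\in\mathbb{Q}$. For $k=1$ the condition $f(x_1)=\cdots=f(x_k)$ is vacuous, so $N_1=q$. *)

theory Defs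
  imports Complex_Main "HOL-Computational_Algebra.Polynomial"
begin

definition value_set :: "'a::comm_semiring_0 poly \<Rightarrow> 'a set" where
  "value_set f = {poly f \<alpha> | \<alpha>. \<alpha> \<in> UNIV}"

(* Points (x_1, ..., x_k) of k-space are lists of length k, indexed from 0. *)
definition equal_value_tuples :: "'a::comm_semiring_0 poly \<Rightarrow> nat \<Rightarrow> 'a list set" where
  "equal_value_tuples f k =
     {xs. length xs = k \<and> (\<forall>i<k. \<forall>j<k. poly f (xs ! i) = poly f (xs ! j))}"

definition elem_sym :: "nat \<Rightarrow> nat \<Rightarrow> (nat \<Rightarrow> 'b::comm_semiring_1) \<Rightarrow> 'b" where
  "elem_sym d i x = (\<Sum>S | S \<subseteq> {1..d} \<and> card S = i. \<Prod>j\<in>S. x j)"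

end

(* Each value v of f has fibre size m with 1 \<le> m \<le> d, and N_i is the sum of the m^i.
   As m is one of 1, ..., d, the product of the 1 - m/j over j = 1, ..., d vanishes; expanding it
   in elementary symmetric functions shows that v contributes exactly 1 to the right-hand side. *)
theory Submission
  imports Defs
begin

text \<open>Expanding the product means choosing \<open>t * x j\<close> or 1 in each factor. The set
  \<open>S\<close> of indices where \<open>t * x j\<close> is chosen gives
  \<open>t ^ card S * prod x S\<close>, and sets of equal size collect into one elementary symmetric
  function.\<close>

lemma prod_one_plus_elem_sym:
  fixes x :: "nat \<Rightarrow> 'b::comm_ring_1"
  shows "(\<Prod>j=1..d. 1 + t * x j) = (\<Sum>i\<le>d. t ^ i * elem_sym d i x)"
proof -
  have "(\<Prod>j=1..d. 1 + t * x j) = (\<Prod>j=1..d. t * x j + 1)"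
    by (simp add: add.commute)
  also have "\<dots> = (\<Sum>S\<in>Pow {1..d}. t ^ card S * prod x S)"
    by (subst prod_add) (simp_all add: prod.distrib)
  also have "\<dots> = (\<Sum>i\<le>d. \<Sum>S | S \<in> Pow {1..d} \<and> card S = i. t ^ card S * prod x S)"
    by (rule sum.group[symmetric]) (auto dest: card_mono[rotated])
  also have "\<dots> = (\<Sum>i\<le>d. t ^ i * elem_sym d i x)"
    unfolding elem_sym_def sum_distrib_left by (intro sum.cong) auto
  finally show ?thesis .
qed

lemma sum_elem_sym_reciprocals:
  assumes "1 \<le> m" "m \<le> d"
  shows "(\<Sum>i=1..d. (-1) ^ (i - 1) * of_nat m ^ i * elem_sym d i (\<lambda>j. 1 / of_nat j)) =
    (1 :: 'b::field_char_0)"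
proof -
  let ?e = "\<lambda>i. elem_sym d i (\<lambda>j. 1 / of_nat j) :: 'b"
  \<comment> \<open>The factor at \<open>j = m\<close> is zero: characteristic 0 and
    \<open>m \<ge> 1\<close> make \<open>of_nat m\<close> invertible.\<close>
  have "0 = (\<Prod>j=1..d. 1 + (- of_nat m) * (1 / of_nat j) :: 'b)"
    using assms by (intro prod_zero[symmetric] bexI[of _ m]) auto
  also have "\<dots> = (\<Sum>i\<le>d. (- of_nat m) ^ i * ?e i)"
    by (rule prod_one_plus_elem_sym)
  also have "{..d} = insert 0 {1..d}"
    by auto
  also have "(\<Sum>i\<in>insert 0 {1..d}. (- of_nat m) ^ i * ?e i) =
      ?e 0 + (\<Sum>i=1..d. (- of_nat m) ^ i * ?e i)"
    by simp
  \<comment> \<open>Infinite sets also have \<open>card\<close> 0; finiteness of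
    \<open>{1..d}\<close> leaves only the empty set.\<close>
  also have "{S. S \<subseteq> {1..d} \<and> card S = 0} = {{}}"
    by (auto dest: finite_subset)
  then have "?e 0 = 1"
    by (simp only: elem_sym_def) simp
  also have "(\<Sum>i=1..d. (- of_nat m) ^ i * ?e i) =
      - (\<Sum>i=1..d. (-1) ^ (i - 1) * of_nat m ^ i * ?e i)"
    unfolding sum_negf[symmetric]
  proof (intro sum.cong refl)
    fix i assume "i \<in> {1..d}"
    \<comment> \<open>With \<open>i\<close> positive, \<open>i - 1\<close> is a true predecessor, so
      the two signs differ by exactly one factor -1.\<close>
    then obtain n where "i = Suc n"
      by (cases i) auto
    then show "(- of_nat m) ^ i * ?e i = - ((-1) ^ (i - 1) * of_nat m ^ i * ?e i)"
      by (simp add: power_minus[of "of_nat m :: 'b"])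
  qed
  finally show ?thesis
    by simp
qed

text \<open>The fibre is the root set of \<open>f - v\<close>. Since \<open>f\<close> has positive
  degree, subtracting a constant keeps the degree and cannot give the zero polynomial.\<close>

lemma card_poly_fibre_le:
  fixes f :: "'a::idom poly"
  assumes "degree f > 0"
  shows "card {\<alpha>. poly f \<alpha> = v} \<le> degree f"
proof -
  have deg: "degree (f + [:- v:]) = degree f"
    using assms by (intro degree_add_eq_left) simp
  with assms have "f + [:- v:] \<noteq> 0"
    by auto
  from card_poly_roots_bound[OF this] deg show ?thesis
    by simp
qed

text \<open>Sorting the tuples by their common value \<open>v\<close> leaves, for each
  \<open>v\<close>, all words of length \<open>k\<close> over the fibre of \<open>v\<close>.\<close>

lemma card_equal_value_tuples:
  fixes f :: "'a::{comm_semiring_0,finite} poly"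
  assumes "k > 0"
  shows "card (equal_value_tuples f k) = (\<Sum>v\<in>value_set f. card {\<alpha>. poly f \<alpha> = v} ^ k)"
proof -
  let ?L = "\<lambda>v. {xs. set xs \<subseteq> {\<alpha>. poly f \<alpha> = v} \<and> length xs = k}"
  have "equal_value_tuples f k = (\<Union>v\<in>value_set f. ?L v)"
  proof (intro equalityI subsetI)
    fix xs assume "xs \<in> equal_value_tuples f k"
    then have len: "length xs = k"
      and eq: "\<And>i j. i < k \<Longrightarrow> j < k \<Longrightarrow> poly f (xs ! i) = poly f (xs ! j)"
      unfolding equal_value_tuples_def by blast+
    have "poly f x = poly f (xs ! 0)" if "x \<in> set xs" for x
      using that len eq[OF _ assms] by (metis in_set_conv_nth)
    with len have "xs \<in> ?L (poly f (xs ! 0))"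
      by blast
    moreover have "poly f (xs ! 0) \<in> value_set f"
      unfolding value_set_def by blast
    ultimately show "xs \<in> (\<Union>v\<in>value_set f. ?L v)"
      by blast
  next
    fix xs assume "xs \<in> (\<Union>v\<in>value_set f. ?L v)"
    then obtain v where "length xs = k" "\<And>x. x \<in> set xs \<Longrightarrow> poly f x = v"
      by blast
    then show "xs \<in> equal_value_tuples f k"
      by (simp add: equal_value_tuples_def)
  qed
  also have "card \<dots> = (\<Sum>v\<in>value_set f. card (?L v))"
  proof (rule card_UN_disjoint)
    \<comment> \<open>Positivity of \<open>k\<close> enters here: the first entry of a common list
      would have both values, whereas the empty list would lie in every \<open>?L v\<close>.\<close>
    show "\<forall>v\<in>value_set f. \<forall>w\<in>value_set f. v \<noteq> w \<longrightarrow> ?L v \<inter> ?L w = {}"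
    proof (intro ballI impI equals0I)
      fix v w xs assume "v \<noteq> w" "xs \<in> ?L v \<inter> ?L w"
      moreover from this assms have "xs ! 0 \<in> set xs"
        by auto
      ultimately show False
        by auto
    qed
  qed (simp_all add: finite_lists_length_eq)
  finally show ?thesis
    by (simp add: card_lists_length_eq)
qed

theorem proposition4:
  fixes f :: "'a::{field,finite} poly" and d :: nat
  assumes "degree f = d" and "d > 0"
  shows "(of_nat (card (value_set f)) :: rat) =
    (\<Sum>i=1..d. (-1) ^ (i - 1) * of_nat (card (equal_value_tuples f i)) *
       elem_sym d i (\<lambda>j. 1 / of_nat j))"
proof -
  let ?m = "\<lambda>v. card {\<alpha>. poly f \<alpha> = v}"
  let ?e = "\<lambda>i. elem_sym d i (\<lambda>j. 1 / of_nat j) :: rat"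
  have "(\<Sum>i=1..d. (-1) ^ (i - 1) * of_nat (card (equal_value_tuples f i)) * ?e i) =
      (\<Sum>i=1..d. \<Sum>v\<in>value_set f. (-1) ^ (i - 1) * of_nat (?m v) ^ i * ?e i)"
    by (intro sum.cong refl)
      (simp add: card_equal_value_tuples sum_distrib_left sum_distrib_right)
  \<comment> \<open>After the exchange the inner sum depends on \<open>v\<close> only through its
    fibre size and equals 1.\<close>
  also have "\<dots> = (\<Sum>v\<in>value_set f. \<Sum>i=1..d. (-1) ^ (i - 1) * of_nat (?m v) ^ i * ?e i)"
    by (rule sum.swap)
  also have "\<dots> = (\<Sum>v\<in>value_set f. 1)"
  proof (intro sum.cong refl sum_elem_sym_reciprocals)
    fix v assume "v \<in> value_set f"
    then have "{\<alpha>. poly f \<alpha> = v} \<noteq> {}"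
      by (auto simp: value_set_def)
    then show "1 \<le> ?m v"
      by (simp add: Suc_le_eq card_gt_0_iff)
    show "?m v \<le> d"
      using assms card_poly_fibre_le by blast
  qed
  finally show ?thesis
    by simp
qed

end
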